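(* Let $\alpha_n$, $n\in\mathbb Z$, be the discrete Hasimoto coordinates of a spin field $\vec S:\mathbb Z\to\mathbb S^2$. The Poisson brackets among the functions $\{\operatorname{Re}\alpha_n,\operatorname{Im}\alpha_n:n\in\mathbb Z\}$ are as follows: $$\{\operatorname{Re}\alpha_n,\operatorname{Im}\alpha_m\}=\begin{cases} -\frac{1+|\alpha_m|^2}{2}\operatorname{Im}\alpha_n\operatorname{Im}(\alpha_{m-1}-\alpha_{m+1}),& n\ge m+2,\\[1ex] -\frac{1+|\alpha_m|^2}{2}\Bigl[\operatorname{Im}\alpha_n\operatorname{Im}(\alpha_{m-1}-\alpha_{m+1})+\frac{1+|\alpha_n|^2}{2}\Bigr],& n=m+1,\\[1ex] \frac{1+|\alpha_n|^2}{2}-\frac{1+|\alpha_n|^2}{2}\operatorname{Re}(\alpha_n\overline{\alpha_{n-1}}),& n=m,\\[1ex] -\frac{1+|\alpha_n|^2}{2}\Bigl[\operatorname{Re}\alpha_m\operatorname{Re}(\alpha_{n-1}-\alpha_{n+1})+\frac{1+|\alpha_m|^2}{2}\Bigr],& n=m-1,\\[1ex] -\frac{1+|\alpha_n|^2}{2}\operatorname{Re}\alpha_m\operatorname{Re}(\alpha_{n-1}-\alpha_{n+1}),& n\le m-2, \end{cases}$$ and, for $n\ge m+1$, $$\{\operatorname{Re}\alpha_n,\operatorname{Re}\alpha_m\}=-\tfrac{1+|\alpha_m|^2}{2}\operatorname{Im}\alpha_n\operatorname{Re}(\alpha_{m-1}-\alpha_{m+1}),$$ $$\{\operatorname{Im}\alpha_n,\operatorname{Im}\alpha_m\}=\tfrac{1+|\alpha_m|^2}{2}\operatorname{Re}\alpha_n\operatorname{Im}(\alpha_{m-1}-\alpha_{m+1}).$$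 These determine all remaining cases through anti-symmetry.
   Context: Poisson bracket on spin fields: for $\vec S:\mathbb Z\to\mathbb S^2\subset\mathbb R^3$ and $\vec a,\vec b\in\mathbb R^3$, $\{\vec a\cdot\vec S_n,\vec b\cdot\vec S_m\}=\delta_{nm}\,\vec a\cdot(\vec S_n\times\vec b)$, extended as an antisymmetric bi-derivation to smooth functions of finitely many spins. Coordinates: for a field with no two consecutive spins parallel or antiparallel, $\theta_n\in(0,\pi)$ and $\gamma_n\in(-\pi,\pi]$ are defined by $$\cos\theta_n=\vec S_n\cdot\vec S_{n+1},\qquad \sin(\theta_{n-1})\sin(\theta_n)e^{i\gamma_n}=(\vec S_{n-1}\times\vec S_n)\cdot(\vec S_n\times\vec S_{n+1})+i\,\vec S_{n-1}\cdot(\vec S_n\times\vec S_{n+1}).$$ Discrete Hasimoto transform: $\alpha_n=\tan(\theta_n/2)e^{-i\Gamma(n)}$ with $\Gamma(n)=\sum_{\ell\le n}\gamma_\ell$, defined for spin fields with no two consecutive spins parallel or antiparallel and with $(\gamma_\ell)$ summable. Since $\Gamma(n)$ depends on infinitely many spins, brackets of the $\alpha_n$ are computed by the chain rule from the brackets of the $\theta_k$ and $\Gamma(n)$, where with $\Gamma_L(n)=\sum_{L\le\ell\le n}\gamma_\ell$ one sets $\{\Gamma(n),\theta_k\}=\lim_{L\to-\infty}\{\Gamma_L(n),\theta_k\}$ and $\{\Gamma(n),\Gamma(m)\}=\lim_{L\to-\infty}\{\Gamma_L(n),\Gamma_L(m)\}$; both are eventually constant in $L$ because brackets among the $\theta$'s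 and $\gamma$'s vanish when the indices differ by more than $2$. (Here $\gamma_\ell$ is treated as a smooth function modulo $2\pi$.) *)

theory Defs
  imports "HOL-Analysis.Analysis"
begin

section \<open>Spin fields and their Poisson bracket\<close>

type_synonym field3 = "int \<Rightarrow> real^3"

definition spin_field :: "field3 \<Rightarrow> bool" where
  "spin_field S \<longleftrightarrow> (\<forall>n. norm (S n) = 1)"

text \<open>Gradient of \<open>F\<close> in the \<open>n\<close>-th spin, tangential to the sphere: \<open>F\<close> is evaluated at unit
  vectors only, since the varied spin is projected back to the sphere by \<open>sgn v = v /\<^sub>R norm v\<close>.\<close>

definition has_spin_grad :: "(field3 \<Rightarrow> real) \<Rightarrow> field3 \<Rightarrow> int \<Rightarrow> real^3 \<Rightarrow> bool" where
  "has_spin_grad F S n g \<longleftrightarrow> GDERIV (\<lambda>v. F (S(n := sgn v))) (S n) :> g"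

definition spin_grad :: "(field3 \<Rightarrow> real) \<Rightarrow> field3 \<Rightarrow> int \<Rightarrow> real^3" where
  "spin_grad F S n = (THE g. has_spin_grad F S n g)"

definition spin_supp :: "(field3 \<Rightarrow> real) \<Rightarrow> field3 \<Rightarrow> int set" where
  "spin_supp F S = {n. spin_grad F S n \<noteq> 0}"

text \<open>\<open>lin_bracket S n a m b\<close> is \<open>{a \<bullet> S\<^sub>n, b \<bullet> S\<^sub>m}\<close>.\<close>

definition lin_bracket :: "field3 \<Rightarrow> int \<Rightarrow> real^3 \<Rightarrow> int \<Rightarrow> real^3 \<Rightarrow> real" where
  "lin_bracket S n a m b = (if n = m then a \<bullet> cross3 (S n) b else 0)"

text \<open>A bi-derivation depends on its arguments only through their differentials. The extension of
  \<open>lin_bracket\<close> to functions of finitely many spins is therefore given by the formula below, where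
  \<open>dF = \<Sum>n. spin_grad F S n \<bullet> dS\<^sub>n\<close>. It has the prescribed values on linear functions, is
  antisymmetric and satisfies the Leibniz rule: see the lemmas \<open>spin_bracket_linear\<close>,
  \<open>spin_bracket_antisym\<close> and \<open>spin_bracket_leibniz\<close>.\<close>

definition spin_bracket :: "(field3 \<Rightarrow> real) \<Rightarrow> (field3 \<Rightarrow> real) \<Rightarrow> field3 \<Rightarrow> real" where
  "spin_bracket F G S =
     (\<Sum>n\<in>spin_supp F S. \<Sum>m\<in>spin_supp G S.
        lin_bracket S n (spin_grad F S n) m (spin_grad G S m))"

section \<open>Discrete Hasimoto coordinates\<close>

definition theta :: "field3 \<Rightarrow> int \<Rightarrow> real" where
  "theta S n = arccos (S n \<bullet> S (n + 1))"

text \<open>The defining equation of \<open>gamma\<close> has the positive factor \<open>sin (theta S (n - 1)) * sin (theta S n)\<close>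
  on its left-hand side; dividing by it does not change the argument (lemma \<open>gamma_props\<close>).\<close>

definition gamma :: "field3 \<Rightarrow> int \<Rightarrow> real" where
  "gamma S n = Arg (Complex (cross3 (S (n - 1)) (S n) \<bullet> cross3 (S n) (S (n + 1)))
                            (S (n - 1) \<bullet> cross3 (S n) (S (n + 1))))"

definition nonparallel :: "field3 \<Rightarrow> bool" where
  "nonparallel S \<longleftrightarrow> (\<forall>n. S (n + 1) \<noteq> S n \<and> S (n + 1) \<noteq> - S n)"

definition hasimoto_domain :: "field3 \<Rightarrow> bool" where
  "hasimoto_domain S \<longleftrightarrow> spin_field S \<and> nonparallel S \<and> gamma S summable_on UNIV"

definition Gamma :: "field3 \<Rightarrow> int \<Rightarrow> real" where
  "Gamma S n = (\<Sum>\<^sub>\<infinity>l\<in>{..n}. gamma S l)"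

definition alpha_of :: "real \<Rightarrow> real \<Rightarrow> complex" where
  "alpha_of t g = of_real (tan (t / 2)) * exp (- \<i> * of_real g)"

definition alpha :: "field3 \<Rightarrow> int \<Rightarrow> complex" where
  "alpha S n = alpha_of (theta S n) (Gamma S n)"

section \<open>Brackets of the Hasimoto coordinates\<close>

text \<open>\<open>gamma_lift S l\<close> is the local branch of the angle \<open>\<gamma>\<^sub>l\<close> (mod \<open>2 * pi\<close>) that agrees with
  \<open>gamma S l\<close> at \<open>S\<close>. Unlike \<open>gamma\<close>, it has no jump near \<open>S\<close> when \<open>gamma S l = pi\<close>.\<close>

definition gamma_lift :: "field3 \<Rightarrow> int \<Rightarrow> field3 \<Rightarrow> real" where
  "gamma_lift S l T = gamma S l + Arg (cis (gamma T l - gamma S l))"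

definition Gamma_lift :: "field3 \<Rightarrow> int \<Rightarrow> int \<Rightarrow> field3 \<Rightarrow> real" where
  "Gamma_lift S L n T = (\<Sum>l\<in>{L..n}. gamma_lift S l T)"

definition bracket_theta_theta :: "field3 \<Rightarrow> int \<Rightarrow> int \<Rightarrow> real" where
  "bracket_theta_theta S n k = spin_bracket (\<lambda>T. theta T n) (\<lambda>T. theta T k) S"

definition bracket_Gamma_theta :: "field3 \<Rightarrow> int \<Rightarrow> int \<Rightarrow> real" where
  "bracket_Gamma_theta S n k =
     Lim at_bot (\<lambda>L. spin_bracket (Gamma_lift S L n) (\<lambda>T. theta T k) S)"

definition bracket_Gamma_Gamma :: "field3 \<Rightarrow> int \<Rightarrow> int \<Rightarrow> real" where
  "bracket_Gamma_Gamma S n m =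
     Lim at_bot (\<lambda>L. spin_bracket (Gamma_lift S L n) (Gamma_lift S L m) S)"

text \<open>The bracket \<open>{f(\<theta>\<^sub>n, \<Gamma>(n)), h(\<theta>\<^sub>m, \<Gamma>(m))}\<close> at \<open>S\<close>, by the chain rule; here
  \<open>{\<theta>\<^sub>n, \<Gamma>(m)} = - {\<Gamma>(m), \<theta>\<^sub>n}\<close>.\<close>

definition hasimoto_bracket ::
    "(real \<Rightarrow> real \<Rightarrow> real) \<Rightarrow> int \<Rightarrow> (real \<Rightarrow> real \<Rightarrow> real) \<Rightarrow> int \<Rightarrow> field3 \<Rightarrow> real" where
  "hasimoto_bracket f n h m S =
     (let f\<^sub>\<theta> = deriv (\<lambda>t. f t (Gamma S n)) (theta S n);
          f\<^sub>\<Gamma> = deriv (\<lambda>g. f (theta S n) g) (Gamma S n);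
          h\<^sub>\<theta> = deriv (\<lambda>t. h t (Gamma S m)) (theta S m);
          h\<^sub>\<Gamma> = deriv (\<lambda>g. h (theta S m) g) (Gamma S m)
      in f\<^sub>\<theta> * h\<^sub>\<theta> * bracket_theta_theta S n m
       + f\<^sub>\<theta> * h\<^sub>\<Gamma> * (- bracket_Gamma_theta S m n)
       + f\<^sub>\<Gamma> * h\<^sub>\<theta> * bracket_Gamma_theta S n m
       + f\<^sub>\<Gamma> * h\<^sub>\<Gamma> * bracket_Gamma_Gamma S n m)"

abbreviation re_alpha :: "real \<Rightarrow> real \<Rightarrow> real" where
  "re_alpha t g \<equiv> Re (alpha_of t g)"

abbreviation im_alpha :: "real \<Rightarrow> real \<Rightarrow> real" where
  "im_alpha t g \<equiv> Im (alpha_of t g)"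

section \<open>Basic properties\<close>

lemma has_spin_grad_unique:
  assumes "has_spin_grad F S n g" "has_spin_grad F S n g'"
  shows "g = g'"
proof -
  have "(\<lambda>h. h \<bullet> g) = (\<lambda>h. h \<bullet> g')"
    using assms unfolding has_spin_grad_def gderiv_def by (rule has_derivative_unique)
  then show ?thesis
    by (metis inner_commute vector_eq_rdot)
qed

lemma spin_grad_eqI: "has_spin_grad F S n g \<Longrightarrow> spin_grad F S n = g"
  unfolding spin_grad_def by (blast intro: the_equality has_spin_grad_unique)

lemma has_spin_grad_indep:
  "(\<And>v. F (S(n := v)) = F S) \<Longrightarrow> has_spin_grad F S n 0"
  unfolding has_spin_grad_def by (simp add: GDERIV_const)

lemma spin_bracket_eq_sum:
  assumes "finite A" "finite (spin_supp F S)" "finite (spin_supp G S)"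
    "spin_supp F S \<inter> spin_supp G S \<subseteq> A"
  shows "spin_bracket F G S = (\<Sum>n\<in>A. spin_grad F S n \<bullet> cross3 (S n) (spin_grad G S n))"
proof -
  have "spin_bracket F G S
      = (\<Sum>n\<in>spin_supp F S. if n \<in> spin_supp G S
           then spin_grad F S n \<bullet> cross3 (S n) (spin_grad G S n) else 0)"
    unfolding spin_bracket_def lin_bracket_def using assms(3) by (simp add: sum.delta)
  also have "\<dots> = (\<Sum>n\<in>spin_supp F S \<inter> spin_supp G S.
                    spin_grad F S n \<bullet> cross3 (S n) (spin_grad G S n))"
    using assms(2) by (simp add: sum.inter_restrict)
  also have "\<dots> = (\<Sum>n\<in>A. spin_grad F S n \<bullet> cross3 (S n) (spin_grad G S n))"
    by (rule sum.mono_neutral_left) (use assms in \<open>auto simp: spin_supp_def\<close>)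
  finally show ?thesis .
qed

lemma spin_bracket_antisym: "spin_bracket F G S = - spin_bracket G F S"
proof -
  have skew: "lin_bracket S n a m b = - lin_bracket S m b n a" for n m a b
  proof (cases "n = m")
    case True
    have "a \<bullet> cross3 (S m) b = - (b \<bullet> cross3 (S m) a)"
      by (simp add: cross3_simps)
    with True show ?thesis unfolding lin_bracket_def by simp
  qed (simp add: lin_bracket_def)
  have "spin_bracket F G S = (\<Sum>n\<in>spin_supp F S. \<Sum>m\<in>spin_supp G S.
        - lin_bracket S m (spin_grad G S m) n (spin_grad F S n))"
    unfolding spin_bracket_def by (intro sum.cong refl skew)
  also have "\<dots> = - spin_bracket G F S"
    unfolding spin_bracket_def by (subst sum.swap) (simp add: sum_negf)
  finally show ?thesis .
qed

lemma spin_bracket_leibniz: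
  assumes S: "spin_field S"
    and F: "\<And>n. \<exists>g. has_spin_grad F S n g" "finite (spin_supp F S)"
    and G: "\<And>n. \<exists>g. has_spin_grad G S n g" "finite (spin_supp G S)"
    and K: "finite (spin_supp K S)"
  shows "spin_bracket (\<lambda>T. F T * G T) K S = F S * spin_bracket G K S + G S * spin_bracket F K S"
proof -
  have upd: "S(n := sgn (S n)) = S" for n
    using S by (simp add: spin_field_def sgn_div_norm)
  have gr: "spin_grad (\<lambda>T. F T * G T) S n = F S *\<^sub>R spin_grad G S n + G S *\<^sub>R spin_grad F S n" for n
  proof -
    obtain g h where gh: "has_spin_grad F S n g" "has_spin_grad G S n h"
      using F(1)[of n] G(1)[of n] by blast
    then have "has_spin_grad (\<lambda>T. F T * G T) S n (F S *\<^sub>R h + G S *\<^sub>R g)"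
      using GDERIV_mult[of "\<lambda>v. F (S(n := sgn v))" "S n" g "\<lambda>v. G (S(n := sgn v))" h]
      unfolding has_spin_grad_def upd by blast
    then show ?thesis
      by (simp only: spin_grad_eqI gh[THEN spin_grad_eqI])
  qed
  let ?A = "spin_supp F S \<union> spin_supp G S"
  have fin: "finite ?A" using F G by blast
  have sub: "spin_supp (\<lambda>T. F T * G T) S \<subseteq> ?A"
    by (auto simp: spin_supp_def gr)
  have eq: "spin_bracket H K S = (\<Sum>n\<in>?A. spin_grad H S n \<bullet> cross3 (S n) (spin_grad K S n))"
    if "spin_supp H S \<subseteq> ?A" for H
    using that fin K by (intro spin_bracket_eq_sum) (auto intro: finite_subset)
  show ?thesis
    unfolding eq[OF sub] eq[OF Un_upper1] eq[OF Un_upper2]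
    by (simp add: gr inner_add_left sum.distrib sum_distrib_left)
qed

lemma has_spin_grad_linear:
  assumes "spin_field S"
  shows "has_spin_grad (\<lambda>T. a \<bullet> T n) S n (a - (a \<bullet> S n) *\<^sub>R S n)"
proof -
  have 1: "norm (S n) = 1" using assms by (simp add: spin_field_def)
  then have nz: "S n \<noteq> 0" by auto
  have "GDERIV (\<lambda>v. inverse (norm v)) (S n) :> - (inverse (norm (S n)))\<^sup>2 *\<^sub>R sgn (S n)"
    using nz by (intro GDERIV_inverse GDERIV_norm) auto
  then have i: "GDERIV (\<lambda>v. inverse (norm v)) (S n) :> - S n"
    using 1 by (simp add: sgn_div_norm)
  have l: "GDERIV (\<lambda>v. a \<bullet> v) (S n) :> a"
    unfolding gderiv_def by (auto intro!: derivative_eq_intros simp: inner_commute)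
  have "GDERIV (\<lambda>v. (a \<bullet> v) * inverse (norm v)) (S n) :> a - (a \<bullet> S n) *\<^sub>R S n"
    using GDERIV_mult[OF l i] 1 by (simp add: algebra_simps)
  then show ?thesis
    unfolding has_spin_grad_def by (simp add: sgn_div_norm mult.commute)
qed

lemma spin_bracket_linear:
  assumes S: "spin_field S"
  shows "spin_bracket (\<lambda>T. a \<bullet> T n) (\<lambda>T. b \<bullet> T m) S
       = (if n = m then a \<bullet> cross3 (S n) b else 0)"
proof -
  have gr: "spin_grad (\<lambda>T. c \<bullet> T k) S l = (if l = k then c - (c \<bullet> S k) *\<^sub>R S k else 0)" for c k l
    using has_spin_grad_linear[OF S, of c k] by (auto intro!: spin_grad_eqI has_spin_grad_indep)
  have sub: "spin_supp (\<lambda>T. c \<bullet> T k) S \<subseteq> {k}" for c k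
    by (auto simp: spin_supp_def gr split: if_splits)
  have fin: "finite (spin_supp (\<lambda>T. c \<bullet> T k) S)" for c k
    using sub finite_subset by blast
  have "spin_bracket (\<lambda>T. a \<bullet> T n) (\<lambda>T. b \<bullet> T m) S
     = (\<Sum>k\<in>{n}. spin_grad (\<lambda>T. a \<bullet> T n) S k \<bullet> cross3 (S k) (spin_grad (\<lambda>T. b \<bullet> T m) S k))"
    by (rule spin_bracket_eq_sum) (use fin sub in blast)+
  also have "\<dots> = (if n = m then a \<bullet> cross3 (S n) b else 0)"
    by (simp add: gr Cross3.right_diff_distrib cross_mult_right inner_diff_left dot_cross_self)
  finally show ?thesis .
qed

lemma inner_consecutive:
  assumes "spin_field S" "nonparallel S"
  shows "\<bar>S n \<bullet> S (n + 1)\<bar> < 1"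
proof -
  have 1: "norm (S n) = 1" "norm (S (n + 1)) = 1"
    using assms by (auto simp: spin_field_def)
  have "\<bar>S n \<bullet> S (n + 1)\<bar> \<noteq> 1"
    using assms(2) 1 norm_cauchy_schwarz_abs_eq[of "S n" "S (n + 1)"]
    by (auto simp: nonparallel_def)
  then show ?thesis
    using Cauchy_Schwarz_ineq2[of "S n" "S (n + 1)"] 1 by simp
qed

lemma theta_props:
  assumes "spin_field S" "nonparallel S"
  shows "0 < theta S n" "theta S n < pi" "cos (theta S n) = S n \<bullet> S (n + 1)"
  using inner_consecutive[OF assms, of n] arccos_lt_bounded[of "S n \<bullet> S (n + 1)"]
  by (auto simp: theta_def cos_arccos_abs)

lemma gamma_props:
  assumes "spin_field S" "nonparallel S"
  shows "- pi < gamma S n" "gamma S n \<le> pi"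
    "of_real (sin (theta S (n - 1)) * sin (theta S n)) * exp (\<i> * of_real (gamma S n))
     = Complex (cross3 (S (n - 1)) (S n) \<bullet> cross3 (S n) (S (n + 1)))
               (S (n - 1) \<bullet> cross3 (S n) (S (n + 1)))"
proof -
  show "- pi < gamma S n" "gamma S n \<le> pi"
    using Arg_bounded by (auto simp: gamma_def)
  let ?a = "S (n - 1)" and ?b = "S n" and ?c = "S (n + 1)"
  let ?z = "Complex (cross3 ?a ?b \<bullet> cross3 ?b ?c) (?a \<bullet> cross3 ?b ?c)"
  have u: "norm (S k) = 1" for k using assms by (simp add: spin_field_def)
  have sn: "sin (theta S k) = norm (cross3 (S k) (S (k + 1)))" for k
  proof -
    have "(sin (theta S k))\<^sup>2 = 1 - (S k \<bullet> S (k + 1))\<^sup>2"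
      using theta_props(3)[OF assms, of k] by (simp add: sin_squared_eq)
    also have "\<dots> = (norm (cross3 (S k) (S (k + 1))))\<^sup>2"
      by (simp add: norm_cross u)
    finally show ?thesis
      using sin_gt_zero[OF theta_props(1,2)[OF assms, of k]] by (simp add: power2_eq_iff_nonneg)
  qed
  have "cross3 (cross3 ?a ?b) (cross3 ?b ?c) = (?a \<bullet> cross3 ?b ?c) *\<^sub>R ?b"
    using cross_triple[of ?a ?b ?c] cross_triple[of ?b ?c ?a]
    by (simp add: Lagrange dot_cross_self inner_commute)
  then have "(cmod ?z)\<^sup>2 = (norm (cross3 ?a ?b) * norm (cross3 ?b ?c))\<^sup>2"
    using norm_cross_dot[of "cross3 ?a ?b" "cross3 ?b ?c"] u[of n] by (simp add: cmod_power2)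
  then have "cmod ?z = norm (cross3 ?a ?b) * norm (cross3 ?b ?c)"
    by (simp add: power2_eq_iff_nonneg)
  then have "cmod ?z = sin (theta S (n - 1)) * sin (theta S n)"
    using sn[of "n - 1"] sn[of n] by simp
  then show "of_real (sin (theta S (n - 1)) * sin (theta S n)) * exp (\<i> * of_real (gamma S n)) = ?z"
    using rcis_cmod_Arg[of ?z] by (simp add: gamma_def rcis_def cis_conv_exp)
qed

lemma gamma_lift_props:
  "gamma_lift S l S = gamma S l" "cis (gamma_lift S l T) = cis (gamma T l)"
proof -
  show "gamma_lift S l S = gamma S l"
    by (simp add: gamma_lift_def)
  have "cis (gamma_lift S l T) = cis (gamma S l) * cis (Arg (cis (gamma T l - gamma S l)))"
    by (simp add: gamma_lift_def cis_mult)
  also have "\<dots> = cis (gamma S l) * cis (gamma T l - gamma S l)"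
    by (simp add: cis_Arg sgn_eq)
  finally show "cis (gamma_lift S l T) = cis (gamma T l)"
    by (simp add: cis_mult)
qed

end

theory Submission
  imports Defs
begin

section \<open>The turning number of three consecutive spins\<close>

text \<open>The spins are the vertices of a spherical polygon with unit binormals e_n, the
  normalised S_n x S_(n+1), and gamma_n is the oriented angle from e_(n-1) to e_n about S_n. By the
  chain rule all brackets reduce to those of theta_k and Gamma(n), which are inner and triple
  products of gradients.

  Since gamma_n is the argument of the complex number \<open>turn\<close>, its gradient comes from a
  logarithmic derivative and is a combination of e_(n-1) and e_n
  (\<open>has_spin_grad_gamma_lift\<close>). In the sum Gamma(n) the coefficients 1/sin theta - cot
  theta collapse to tan(theta/2) = |alpha| (\<open>spin_grad_Gamma_lift_bulk\<close>), so the
  brackets of angles involve the moduli of neighbouring alphas and the sines and cosines of gamma.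

  For n >= m+2, theta_n commutes with theta_m and Gamma(m), so alpha_n meets alpha_m only through
  Gamma(n). The angle brackets amount to {Gamma(n), alpha_m} = (1+|alpha_m|^2)/2 (alpha_(m+1) -
  alpha_(m-1)), because gamma_k = Gamma(k) - Gamma(k-1) turns the phase of alpha_m into those of its
  neighbours. With {Re alpha_n, .} = Im alpha_n {Gamma(n), .} and {Im alpha_n, .} = - Re alpha_n
  {Gamma(n), .} this is \<open>hasimoto_bracket_far\<close>. For n = m+1 all four angle brackets add
  a correction; these combine to a constant multiple of both weights in the mixed brackets and
  cancel in the others (\<open>hasimoto_bracket_succ\<close>). For n = m only {Gamma(n), theta_n}
  survives (\<open>hasimoto_bracket_same\<close>). Antisymmetry gives n < m.\<close>

definition turn :: "real^3 \<Rightarrow> real^3 \<Rightarrow> real^3 \<Rightarrow> complex" where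
  "turn a b c = Complex (cross3 a b \<bullet> cross3 b c) (a \<bullet> cross3 b c)"

lemma gamma_eq_Arg_turn: "gamma S n = Arg (turn (S (n - 1)) (S n) (S (n + 1)))"
  by (simp add: gamma_def turn_def)

text \<open>By cyclicity \<open>q \<bullet> cross3 b x\<close> is
  \<open>cross3 q b \<bullet> x\<close>, so the left side is an inner product of two cross products,
  one of which is the double product of \<open>q\<close> and \<open>b\<close>; orthogonality
  collapses that to a multiple of \<open>b\<close>.\<close>

lemma orthogonal_cross_identity:
  assumes "q \<bullet> b = 0"
  shows "(q \<bullet> cross3 b c) * (q \<bullet> h) - (q \<bullet> cross3 b h) * (q \<bullet> c) = (q \<bullet> q) * (h \<bullet> cross3 b c)"
proof -
  have "q \<bullet> cross3 b x = cross3 q b \<bullet> x" for x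
    using cross_triple[of q b x] by (simp add: inner_commute)
  then have "(q \<bullet> cross3 b c) * (q \<bullet> h) - (q \<bullet> cross3 b h) * (q \<bullet> c)
      = cross3 (cross3 q b) q \<bullet> cross3 c h"
    by (simp add: dot_cross)
  also have "cross3 (cross3 q b) q = (q \<bullet> q) *\<^sub>R b"
  proof -
    have "cross3 (cross3 q b) q = (q \<bullet> q) *\<^sub>R b - (q \<bullet> b) *\<^sub>R q"
      by (simp add: cross3_simps forall_3)
    with assms show ?thesis by simp
  qed
  also have "(q \<bullet> q) *\<^sub>R b \<bullet> cross3 c h = (q \<bullet> q) * (h \<bullet> cross3 b c)"
    using cross_triple[of b c h] by (simp add: inner_commute)
  finally show ?thesis .
qed

text \<open>For linear dependence on the varied spin, Im (z' * cnj z) is |z|^2 times the derivative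
  of the argument of z. Both coordinates of \<open>turn\<close> pair the last spin with
  \<open>q = cross3 a b\<close>, which is orthogonal to \<open>b\<close>.\<close>

lemma Im_turn_right:
  "Im (turn a b h * cnj (turn a b c)) = (norm (cross3 a b))\<^sup>2 * (h \<bullet> cross3 b c)"
proof -
  have "a \<bullet> cross3 b x = cross3 a b \<bullet> x" for x
    using cross_triple[of a b x] by (simp add: inner_commute)
  then show ?thesis
    using orthogonal_cross_identity[of "cross3 a b" b c h]
    by (simp add: turn_def dot_cross_self dot_square_norm algebra_simps)
qed

lemma Im_turn_left:
  "Im (turn h b c * cnj (turn a b c)) = (norm (cross3 b c))\<^sup>2 * (h \<bullet> cross3 a b)"
proof -
  have "cross3 x b = - cross3 b x" for x
    by (rule cross_skew)
  then show ?thesis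
    using orthogonal_cross_identity[of "cross3 b c" b a h]
    by (simp add: turn_def dot_cross_self dot_square_norm inner_commute algebra_simps)
qed

text \<open>The derivative of \<open>turn a b c\<close> in \<open>b\<close> along \<open>h\<close>.
  The real part is quadratic in the middle spin, hence two terms.\<close>

definition turn_middle :: "real^3 \<Rightarrow> real^3 \<Rightarrow> real^3 \<Rightarrow> real^3 \<Rightarrow> complex" where
  "turn_middle a b c h =
     Complex (cross3 a h \<bullet> cross3 b c + cross3 a b \<bullet> cross3 h c) (a \<bullet> cross3 h c)"

text \<open>The infinitesimal form of invariance under simultaneous rotation.\<close>

lemma turn_rotation:
  "turn (cross3 w a) b c + turn_middle a b c (cross3 w b) + turn a b (cross3 w c) = 0"
proof -
  have jac: "cross3 (cross3 w x) y = cross3 w (cross3 x y) - cross3 x (cross3 w y)" for x y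
    by (simp add: cross3_simps)
  have skew: "cross3 w x \<bullet> y = - (x \<bullet> cross3 w y)" for x y
    by (simp add: cross3_simps)
  show ?thesis
    by (simp add: turn_def turn_middle_def complex_eq_iff jac skew inner_diff_left inner_diff_right)
qed

lemma Im_turn_middle:
  assumes b: "norm b = 1" and h: "h \<bullet> b = 0"
  shows "Im (turn_middle a b c h * cnj (turn a b c)) =
    - ((a \<bullet> b) * (norm (cross3 b c))\<^sup>2 * (h \<bullet> cross3 a b)
       + (b \<bullet> c) * (norm (cross3 a b))\<^sup>2 * (h \<bullet> cross3 b c))"
proof -
  \<comment> \<open>The angular velocity whose rotation moves \<open>b\<close> exactly by the
    tangent vector \<open>h\<close>. Rotation invariance then trades the displacement of
    \<open>b\<close> for opposite ones of \<open>a\<close> and \<open>c\<close>.\<close>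
  define w where "w = cross3 b h"
  have "cross3 w b = (b \<bullet> b) *\<^sub>R h - (h \<bullet> b) *\<^sub>R b"
    by (simp add: w_def cross3_simps forall_3)
  then have wb: "cross3 w b = h"
    using b h by (simp add: dot_square_norm)
  have eq: "turn_middle a b c h = - turn (cross3 w a) b c - turn a b (cross3 w c)"
    using turn_rotation[of w a b c] unfolding wb by (simp add: algebra_simps eq_neg_iff_add_eq_0)
  have wb0: "w \<bullet> b = 0"
    by (simp add: w_def dot_cross_self)
  have 1: "cross3 w a \<bullet> cross3 a b = (a \<bullet> b) * (h \<bullet> cross3 a b)"
    using wb0 cross_triple[of a b h] cross_triple[of b h a]
    by (simp add: dot_cross w_def inner_commute mult.commute)
  have 2: "cross3 w c \<bullet> cross3 b c = (b \<bullet> c) * (h \<bullet> cross3 b c)"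
  proof -
    have "w \<bullet> c = - (h \<bullet> cross3 b c)"
      unfolding w_def by (simp add: cross3_simps)
    with wb0 show ?thesis
      by (simp add: dot_cross inner_commute mult.commute)
  qed
  have "Im (turn_middle a b c h * cnj (turn a b c)) =
      - Im (turn (cross3 w a) b c * cnj (turn a b c)) - Im (turn a b (cross3 w c) * cnj (turn a b c))"
    unfolding eq by (simp only: left_diff_distrib mult_minus_left minus_complex.sel uminus_complex.sel)
  then show ?thesis
    unfolding Im_turn_left Im_turn_right 1 2 by (simp add: algebra_simps)
qed

section \<open>Derivatives of the turn in each of its three spins\<close>

lemma has_derivative_Complex:
  assumes "(f has_derivative f') F" "(g has_derivative g') F"
  shows "((\<lambda>x. Complex (f x) (g x)) has_derivative (\<lambda>h. Complex (f' h) (g' h))) F"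
  unfolding Complex_eq
  by (intro has_derivative_add has_derivative_mult_right has_derivative_of_real assms)

lemma bounded_bilinear_cross3: "bounded_bilinear cross3"
  using bilinear_cross bilinear_conv_bounded_bilinear by blast

lemmas has_derivative_cross3 [derivative_intros] =
  bounded_bilinear.FDERIV[OF bounded_bilinear_cross3]

lemma turn_has_derivative_left:
  "((\<lambda>v. turn v b c) has_derivative (\<lambda>h. turn h b c)) (at w)"
  unfolding turn_def by (auto intro!: has_derivative_Complex derivative_eq_intros)

lemma turn_has_derivative_middle:
  "((\<lambda>v. turn a v c) has_derivative turn_middle a w c) (at w)"
proof -
  have "((\<lambda>v. turn a v c) has_derivative (\<lambda>h. turn_middle a w c h)) (at w)"
    unfolding turn_def turn_middle_def
    by (auto intro!: has_derivative_Complex derivative_eq_intros)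
  then show ?thesis by simp
qed

lemma turn_has_derivative_right:
  "((\<lambda>v. turn a b v) has_derivative (\<lambda>h. turn a b h)) (at w)"
  unfolding turn_def by (auto intro!: has_derivative_Complex derivative_eq_intros)

section \<open>Spin gradients\<close>

lemma sgn_has_derivative:
  fixes w :: "real^3"
  assumes "norm w = 1"
  shows "(sgn has_derivative (\<lambda>h. h - (h \<bullet> w) *\<^sub>R w)) (at w)"
proof -
  have nz: "w \<noteq> 0" using assms by auto
  have "((\<lambda>v. inverse (norm v) *\<^sub>R v) has_derivative (\<lambda>h. h - (h \<bullet> w) *\<^sub>R w)) (at w)"
    using nz assms by (auto intro!: derivative_eq_intros has_derivative_norm simp: sgn_div_norm)
  then show ?thesis
    by (simp add: sgn_div_norm[abs_def])
qed

text \<open>The derivative of \<open>sgn\<close> at a unit vector is the tangential projection. An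
  ambient derivative \<open>D\<close> thus need only agree with \<open>g\<close> on tangent
  vectors.\<close>

lemma has_spin_gradI:
  assumes S: "spin_field S"
    and D: "((\<lambda>v. F (S(n := v))) has_derivative D) (at (S n))"
    and g: "g \<bullet> S n = 0" "\<And>h. h \<bullet> S n = 0 \<Longrightarrow> D h = h \<bullet> g"
  shows "has_spin_grad F S n g"
proof -
  have 1: "norm (S n) = 1" using S by (simp add: spin_field_def)
  then have s: "sgn (S n) = S n" by (simp add: sgn_div_norm)
  have "((\<lambda>v. F (S(n := sgn v))) has_derivative (\<lambda>h. D (h - (h \<bullet> S n) *\<^sub>R S n))) (at (S n))"
    using has_derivative_compose[OF sgn_has_derivative[OF 1], of "\<lambda>v. F (S(n := v))" D] D
    by (simp add: s)
  moreover have "D (h - (h \<bullet> S n) *\<^sub>R S n) = h \<bullet> g" for h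
    using 1 g by (simp add: inner_diff_left dot_square_norm inner_commute[of "S n" g])
  ultimately show ?thesis
    by (simp add: has_spin_grad_def gderiv_def)
qed

lemma has_spin_grad_sum:
  assumes "\<And>i. i \<in> I \<Longrightarrow> has_spin_grad (F i) S n (g i)"
  shows "has_spin_grad (\<lambda>T. \<Sum>i\<in>I. F i T) S n (\<Sum>i\<in>I. g i)"
  using assms unfolding has_spin_grad_def gderiv_def inner_sum_right
  by (rule has_derivative_sum)

section \<open>The lifted angle as an imaginary part of a logarithm\<close>

lemma Arg_sgn: "Arg (sgn z) = Arg z"
  by (cases "z = 0") (simp_all add: sgn_div_norm scaleR_conv_of_real del: of_real_inverse)

text \<open>Dividing by the turn at \<open>S\<close> moves the base point to 1, away from the cut of
  \<open>Ln\<close>; this makes the lift smooth at \<open>S\<close> even when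
  \<open>gamma S l\<close> is pi.\<close>

lemma gamma_lift_eq_Im_Ln:
  assumes "turn (T (l - 1)) (T l) (T (l + 1)) \<noteq> 0" (is "?z \<noteq> 0")
    and "turn (S (l - 1)) (S l) (S (l + 1)) \<noteq> 0" (is "?w \<noteq> 0")
  shows "gamma_lift S l T = gamma S l + Im (Ln (?z / ?w))"
proof -
  have "cis (gamma T l - gamma S l) = cis (gamma T l) / cis (gamma S l)"
    by (simp add: cis_divide)
  also have "\<dots> = sgn (?z / ?w)"
    using assms by (simp add: gamma_eq_Arg_turn cis_Arg sgn_divide)
  finally have "Arg (cis (gamma T l - gamma S l)) = Arg (?z / ?w)"
    by (simp only: Arg_sgn)
  then show ?thesis
    using assms by (simp add: gamma_lift_def Arg_eq_Im_Ln)
qed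

text \<open>\<open>Z\<close> is the turn as a function of whichever spin is varied, so that one
  logarithmic derivative serves all three slots. The formula with \<open>Ln\<close> is available
  where \<open>Z\<close> is nonzero, which holds near \<open>w\<close>.\<close>

lemma gamma_lift_has_derivative:
  assumes Z: "(Z has_derivative Z') (at w)"
    and T: "\<And>v. turn (T v (l - 1)) (T v l) (T v (l + 1)) = Z v"
    and w: "Z w = turn (S (l - 1)) (S l) (S (l + 1))" "Z w \<noteq> 0"
  shows "((\<lambda>v. gamma_lift S l (T v)) has_derivative
    (\<lambda>h. Im (Z' h * cnj (Z w)) / (cmod (Z w))\<^sup>2)) (at w)"
proof -
  have "((\<lambda>v. Z v / Z w) has_derivative (\<lambda>h. Z' h / Z w)) (at w)"
    using has_derivative_mult_left[OF Z, of "inverse (Z w)"] by (simp add: divide_inverse)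
  moreover have "(Ln has_derivative (*) 1) (at (Z w / Z w))"
    using has_field_derivative_Ln[of 1] w(2) by (simp add: has_field_derivative_def)
  ultimately have "((\<lambda>v. Ln (Z v / Z w)) has_derivative (\<lambda>h. Z' h / Z w)) (at w)"
    using has_derivative_compose by fastforce
  then have "((\<lambda>v. Im (Ln (Z v / Z w))) has_derivative (\<lambda>h. Im (Z' h / Z w))) (at w)"
    by (rule bounded_linear.has_derivative[OF bounded_linear_Im])
  then have "((\<lambda>v. gamma S l + Im (Ln (Z v / Z w))) has_derivative (\<lambda>h. Im (Z' h / Z w))) (at w)"
    using has_derivative_add[OF has_derivative_const] by fastforce
  moreover have "\<forall>\<^sub>F v in at w. gamma S l + Im (Ln (Z v / Z w)) = gamma_lift S l (T v)"
  proof -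
    have "(Z \<longlongrightarrow> Z w) (at w)"
      using has_derivative_continuous[OF Z] by (simp add: continuous_at)
    then have "\<forall>\<^sub>F v in at w. Z v \<noteq> 0"
      using w(2) by (rule tendsto_imp_eventually_ne)
    then show ?thesis
      by eventually_elim (use w T in \<open>simp add: gamma_lift_eq_Im_Ln\<close>)
  qed
  moreover have "gamma S l + Im (Ln (Z w / Z w)) = gamma_lift S l (T w)"
    using w T by (simp add: gamma_lift_eq_Im_Ln)
  ultimately have "((\<lambda>v. gamma_lift S l (T v)) has_derivative (\<lambda>h. Im (Z' h / Z w))) (at w)"
    by (rule has_derivative_transform_eventually) simp
  moreover have "Im (Z' h / Z w) = Im (Z' h * cnj (Z w)) / (cmod (Z w))\<^sup>2" for h
    by (simp add: complex_div_cnj[of "Z' h"] del: of_real_power flip: of_real_power)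
  ultimately show ?thesis by simp
qed

text \<open>The Hasimoto variables only involve the geometry of the spherical polygon with vertices
  \<open>S n\<close>. In terms of its unit binormals \<open>e n\<close>, the gradient of \<open>\<gamma> l\<close> in the spins
  \<open>l - 1, l, l + 1\<close> is \<open>e (l - 1) / sin (\<theta> (l - 1))\<close>,
  \<open>- cot (\<theta> (l - 1)) e (l - 1) - cot (\<theta> l) e l\<close>, \<open>e l / sin (\<theta> l)\<close>; the middle one follows from
  the outer two by rotation invariance. Summing over \<open>l\<close>, the coefficients of each \<open>e k\<close> combine
  to \<open>tan (\<theta> k / 2)\<close>.\<close>

definition binormal :: "field3 \<Rightarrow> int \<Rightarrow> real^3" where
  "binormal S n = cross3 (S n) (S (n + 1)) /\<^sub>R sin (theta S n)"

text \<open>The unit tangents to the great-circle arc at its two endpoints, pointing out of the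
  arc.\<close>

definition theta_grad :: "field3 \<Rightarrow> int \<Rightarrow> int \<Rightarrow> real^3" where
  "theta_grad S n k =
     (if k = n then cross3 (S k) (binormal S n)
      else if k = n + 1 then - cross3 (S k) (binormal S n)
      else 0)"

definition gamma_grad :: "field3 \<Rightarrow> int \<Rightarrow> int \<Rightarrow> real^3" where
  "gamma_grad S l k =
     (if k = l - 1 then binormal S k /\<^sub>R sin (theta S k)
      else if k = l then - (cot (theta S (k - 1)) *\<^sub>R binormal S (k - 1)) - cot (theta S k) *\<^sub>R binormal S k
      else if k = l + 1 then binormal S (k - 1) /\<^sub>R sin (theta S (k - 1))
      else 0)"

text \<open>The gradient of \<open>\<Gamma>\<^sub>L(n)\<close> in the \<open>k\<close>-th spin, for \<open>L < k\<close>.\<close>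

definition Gamma_grad :: "field3 \<Rightarrow> int \<Rightarrow> int \<Rightarrow> real^3" where
  "Gamma_grad S n k =
     (if k < n then
        tan (theta S (k - 1) / 2) *\<^sub>R binormal S (k - 1) + tan (theta S k / 2) *\<^sub>R binormal S k
      else if k = n then
        tan (theta S (k - 1) / 2) *\<^sub>R binormal S (k - 1) - cot (theta S k) *\<^sub>R binormal S k
      else if k = n + 1 then binormal S (k - 1) /\<^sub>R sin (theta S (k - 1))
      else 0)"

section \<open>Geometry of the spherical polygon\<close>

locale nonparallel_spin_field =
  fixes S :: field3
  assumes spin: "spin_field S" and nonparallel: "nonparallel S"
begin

abbreviation "e \<equiv> binormal S"
abbreviation "\<theta> \<equiv> theta S"
abbreviation "\<gamma> \<equiv> gamma S"

lemma norm_spin [simp]: "norm (S n) = 1"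
  using spin by (simp add: spin_field_def)

lemma inner_spin_self [simp]: "S n \<bullet> S n = 1"
  by (simp add: dot_square_norm)

lemma sin_theta_pos: "0 < sin (\<theta> n)"
  using theta_props[OF spin nonparallel, of n] by (simp add: sin_gt_zero)

lemma sin_theta_nonzero [simp]: "sin (\<theta> n) \<noteq> 0"
  using sin_theta_pos[of n] by simp

lemma norm_cross_spin: "norm (cross3 (S n) (S (n + 1))) = sin (\<theta> n)"
proof -
  have "(sin (\<theta> n))\<^sup>2 = (norm (cross3 (S n) (S (n + 1))))\<^sup>2"
    using theta_props(3)[OF spin nonparallel, of n] by (simp add: sin_squared_eq norm_cross)
  then show ?thesis
    using sin_theta_pos[of n] by (simp add: power2_eq_iff_nonneg)
qed

lemma cross_spin: "cross3 (S n) (S (n + 1)) = sin (\<theta> n) *\<^sub>R e n"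
  by (simp add: binormal_def)

lemma binormal_orthogonal [simp]:
  "e n \<bullet> S n = 0" "e n \<bullet> S (n + 1) = 0" "e (n - 1) \<bullet> S n = 0"
  "S n \<bullet> e n = 0" "S (n + 1) \<bullet> e n = 0" "S n \<bullet> e (n - 1) = 0"
  using dot_cross_self[of "S (n - 1)" "S n"] dot_cross_self[of "S n" "S (n + 1)"]
  by (simp_all add: binormal_def inner_commute)

lemma inner_binormal_self [simp]: "e n \<bullet> e n = 1"
  using norm_cross_spin[of n] sin_theta_pos[of n]
  by (simp add: binormal_def dot_square_norm power2_eq_square)

lemma cross_cross_orthogonal:
  assumes "x \<bullet> S n = 0"
  shows "cross3 (S n) (cross3 (S n) x) = - x"
  using assms by (simp add: Lagrange inner_commute)

abbreviation "turn_at n \<equiv> turn (S (n - 1)) (S n) (S (n + 1))"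

lemma turn_at_polar: "turn_at n = rcis (sin (\<theta> (n - 1)) * sin (\<theta> n)) (\<gamma> n)"
  using gamma_props(3)[OF spin nonparallel, of n] by (simp add: turn_def rcis_def cis_conv_exp)

lemma norm_turn_at: "cmod (turn_at n) = sin (\<theta> (n - 1)) * sin (\<theta> n)"
  using sin_theta_pos[of n] sin_theta_pos[of "n - 1"] by (simp add: turn_at_polar abs_mult)

lemma turn_at_nonzero: "turn_at n \<noteq> 0"
  using norm_turn_at[of n] by force

text \<open>Both binormals lie in the plane orthogonal to \<open>S n\<close>, and \<gamma> is the
  oriented angle between them; \<open>triple_binormal\<close> supplies the sine.\<close>

lemma inner_binormal_prev: "e (n - 1) \<bullet> e n = cos (\<gamma> n)"
proof -
  have "sin (\<theta> (n - 1)) * sin (\<theta> n) * cos (\<gamma> n) = Re (turn_at n)"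
    by (simp add: turn_at_polar)
  also have "\<dots> = sin (\<theta> (n - 1)) * sin (\<theta> n) * (e (n - 1) \<bullet> e n)"
    using cross_spin[of "n - 1"] cross_spin[of n] by (simp add: turn_def)
  finally show ?thesis by simp
qed

lemma triple_binormal: "S n \<bullet> cross3 (e (n - 1)) (e n) = sin (\<gamma> n)"
proof -
  let ?a = "S (n - 1)" and ?b = "S n" and ?c = "S (n + 1)"
  have "sin (\<theta> (n - 1)) * sin (\<theta> n) * sin (\<gamma> n) = Im (turn_at n)"
    by (simp add: turn_at_polar)
  also have "\<dots> = S n \<bullet> cross3 (cross3 ?a ?b) (cross3 ?b ?c)"
  proof -
    have "cross3 (cross3 ?a ?b) (cross3 ?b ?c) = (?a \<bullet> cross3 ?b ?c) *\<^sub>R ?b"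
      using cross_triple[of ?a ?b ?c] cross_triple[of ?b ?c ?a]
      by (simp add: Lagrange dot_cross_self inner_commute)
    then show ?thesis by (simp add: turn_def)
  qed
  also have "\<dots> = sin (\<theta> (n - 1)) * sin (\<theta> n) * (S n \<bullet> cross3 (e (n - 1)) (e n))"
    using cross_spin[of "n - 1"] cross_spin[of n] by (simp add: cross_mult_left cross_mult_right)
  finally show ?thesis by simp
qed

lemma inner_cross_binormal:
  "e (n - 1) \<bullet> cross3 (S n) (e n) = - sin (\<gamma> n)"
  "e n \<bullet> cross3 (S n) (e (n - 1)) = sin (\<gamma> n)"
proof -
  show "e n \<bullet> cross3 (S n) (e (n - 1)) = sin (\<gamma> n)"
    using triple_binormal[of n] cross_triple[of "S n" "e (n - 1)" "e n"] by (simp add: inner_commute)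
  then show "e (n - 1) \<bullet> cross3 (S n) (e n) = - sin (\<gamma> n)"
    using cross_triple[of "S n" "e (n - 1)" "e n"] cross_triple[of "S n" "e n" "e (n - 1)"]
      cross_skew[of "e n" "e (n - 1)"]
    by (simp add: inner_commute)
qed

section \<open>Gradients of the angles\<close>

lemma arccos_has_derivative:
  "((\<lambda>v. arccos (v \<bullet> u)) has_derivative (\<lambda>h. - (h \<bullet> u) / sin (\<theta> n))) (at w)"
  if "w \<bullet> u = S n \<bullet> S (n + 1)"
proof -
  have c: "w \<bullet> u = cos (\<theta> n)" "\<bar>w \<bullet> u\<bar> < 1"
    using that theta_props(3)[OF spin nonparallel] inner_consecutive[OF spin nonparallel] by simp_all
  have "sqrt (1 - (w \<bullet> u)\<^sup>2) = sin (\<theta> n)"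
    using sin_theta_pos[of n] by (simp add: c sin_squared_eq[symmetric])
  then have "(arccos has_real_derivative - inverse (sin (\<theta> n))) (at (w \<bullet> u))"
    using DERIV_arccos[of "w \<bullet> u"] c(2) by (simp add: abs_less_iff)
  moreover have "((\<lambda>v. v \<bullet> u) has_derivative (\<lambda>h. h \<bullet> u)) (at w)"
    by (auto intro!: derivative_eq_intros)
  ultimately show ?thesis
    using has_derivative_compose[of "\<lambda>v. v \<bullet> u" "\<lambda>h. h \<bullet> u" w UNIV arccos]
    by (force simp: has_field_derivative_def divide_inverse mult.commute)
qed

lemma has_spin_grad_theta: "has_spin_grad (\<lambda>T. theta T n) S k (theta_grad S n k)"
proof -
  consider "k = n" | "k = n + 1" | "k \<noteq> n" "k \<noteq> n + 1" by blast
  then show ?thesis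
  proof cases
    case 1
    show ?thesis
    proof (rule has_spin_gradI[OF spin])
      show "((\<lambda>v. theta (S(k := v)) n) has_derivative (\<lambda>h. - (h \<bullet> S (n + 1)) / sin (\<theta> n))) (at (S k))"
        unfolding theta_def[of "S(_ := _)"] using 1 arccos_has_derivative[of "S n" "S (n + 1)" n] by simp
      show "theta_grad S n k \<bullet> S k = 0"
        by (simp add: theta_grad_def 1 dot_cross_self)
      show "- (h \<bullet> S (n + 1)) / sin (\<theta> n) = h \<bullet> theta_grad S n k" if "h \<bullet> S k = 0" for h
        using that by (simp add: theta_grad_def 1 binormal_def cross_mult_right Lagrange
            inner_diff_right divide_inverse)
    qed
  next
    case 2
    show ?thesis
    proof (rule has_spin_gradI[OF spin])
      show "((\<lambda>v. theta (S(k := v)) n) has_derivative (\<lambda>h. - (h \<bullet> S n) / sin (\<theta> n))) (at (S k))"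
        unfolding theta_def[of "S(_ := _)"] using 2 arccos_has_derivative[of "S (n + 1)" "S n" n]
        by (simp add: inner_commute)
      show "theta_grad S n k \<bullet> S k = 0"
        by (simp add: theta_grad_def 2 dot_cross_self)
      show "- (h \<bullet> S n) / sin (\<theta> n) = h \<bullet> theta_grad S n k" if "h \<bullet> S k = 0" for h
        using that by (simp add: theta_grad_def 2 binormal_def cross_mult_right Lagrange
            inner_diff_right divide_inverse)
    qed
  next
    case 3
    then show ?thesis
      by (auto simp: theta_grad_def theta_def intro!: has_spin_grad_indep)
  qed
qed

lemma has_spin_grad_gamma_lift: "has_spin_grad (gamma_lift S l) S k (gamma_grad S l k)"
proof -
  let ?a = "S (l - 1)" and ?b = "S l" and ?c = "S (l + 1)"
  have sq: "(cmod (turn_at l))\<^sup>2 = (sin (\<theta> (l - 1)))\<^sup>2 * (sin (\<theta> l))\<^sup>2"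
    by (simp add: norm_turn_at power_mult_distrib)
  have cs: "cross3 ?a ?b = sin (\<theta> (l - 1)) *\<^sub>R e (l - 1)" "cross3 ?b ?c = sin (\<theta> l) *\<^sub>R e l"
    using cross_spin[of "l - 1"] cross_spin[of l] by simp_all
  have nc: "norm (cross3 ?a ?b) = sin (\<theta> (l - 1))" "norm (cross3 ?b ?c) = sin (\<theta> l)"
    using norm_cross_spin[of "l - 1"] norm_cross_spin[of l] by simp_all
  have co: "?a \<bullet> ?b = cos (\<theta> (l - 1))" "?b \<bullet> ?c = cos (\<theta> l)"
    using theta_props(3)[OF spin nonparallel, of "l - 1"] theta_props(3)[OF spin nonparallel, of l] by simp_all
  consider "k = l - 1" | "k = l" | "k = l + 1" | "k \<noteq> l - 1" "k \<noteq> l" "k \<noteq> l + 1" by blast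
  then show ?thesis
  proof cases
    case 1
    show ?thesis
    proof (rule has_spin_gradI[OF spin])
      show "((\<lambda>v. gamma_lift S l (S(k := v))) has_derivative
          (\<lambda>h. Im (turn h ?b ?c * cnj (turn (S k) ?b ?c)) / (cmod (turn (S k) ?b ?c))\<^sup>2)) (at (S k))"
        by (rule gamma_lift_has_derivative[OF turn_has_derivative_left]) (use 1 turn_at_nonzero in simp_all)
      show "gamma_grad S l k \<bullet> S k = 0"
        by (simp add: gamma_grad_def 1)
      show "Im (turn h ?b ?c * cnj (turn (S k) ?b ?c)) / (cmod (turn (S k) ?b ?c))\<^sup>2 = h \<bullet> gamma_grad S l k" for h
        unfolding 1 Im_turn_left sq nc unfolding cs
        by (simp add: gamma_grad_def field_simps power2_eq_square)
    qed
  next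
    case 2
    show ?thesis
    proof (rule has_spin_gradI[OF spin])
      show "((\<lambda>v. gamma_lift S l (S(k := v))) has_derivative
          (\<lambda>h. Im (turn_middle ?a (S k) ?c h * cnj (turn ?a (S k) ?c)) / (cmod (turn ?a (S k) ?c))\<^sup>2)) (at (S k))"
        by (rule gamma_lift_has_derivative[OF turn_has_derivative_middle]) (use 2 turn_at_nonzero in simp_all)
      show "gamma_grad S l k \<bullet> S k = 0"
        by (simp add: gamma_grad_def 2 inner_diff_left)
      show "Im (turn_middle ?a (S k) ?c h * cnj (turn ?a (S k) ?c)) / (cmod (turn ?a (S k) ?c))\<^sup>2
          = h \<bullet> gamma_grad S l k" if "h \<bullet> S k = 0" for h
        unfolding 2 Im_turn_middle[OF norm_spin that[unfolded 2]] sq nc co unfolding cs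
        by (simp add: gamma_grad_def inner_diff_right cot_def field_simps power2_eq_square)
    qed
  next
    case 3
    show ?thesis
    proof (rule has_spin_gradI[OF spin])
      show "((\<lambda>v. gamma_lift S l (S(k := v))) has_derivative
          (\<lambda>h. Im (turn ?a ?b h * cnj (turn ?a ?b (S k))) / (cmod (turn ?a ?b (S k)))\<^sup>2)) (at (S k))"
        by (rule gamma_lift_has_derivative[OF turn_has_derivative_right]) (use 3 turn_at_nonzero in simp_all)
      show "gamma_grad S l k \<bullet> S k = 0"
        by (simp add: gamma_grad_def 3)
      show "Im (turn ?a ?b h * cnj (turn ?a ?b (S k))) / (cmod (turn ?a ?b (S k)))\<^sup>2 = h \<bullet> gamma_grad S l k" for h
        unfolding 3 Im_turn_right sq nc unfolding cs
        by (simp add: gamma_grad_def field_simps power2_eq_square)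
    qed
  next
    case 4
    then show ?thesis
      by (auto simp: gamma_grad_def gamma_lift_def gamma_def intro!: has_spin_grad_indep)
  qed
qed

lemma spin_grad_theta: "spin_grad (\<lambda>T. theta T n) S = theta_grad S n"
  by (rule ext) (rule spin_grad_eqI[OF has_spin_grad_theta])

lemma spin_grad_Gamma_lift: "spin_grad (Gamma_lift S L n) S k = (\<Sum>l\<in>{L..n}. gamma_grad S l k)"
proof (rule spin_grad_eqI)
  show "has_spin_grad (Gamma_lift S L n) S k (\<Sum>l\<in>{L..n}. gamma_grad S l k)"
    unfolding Gamma_lift_def[abs_def] by (intro has_spin_grad_sum has_spin_grad_gamma_lift)
qed

lemma finite_supp_theta: "finite (spin_supp (\<lambda>T. theta T n) S)"
  by (rule finite_subset[of _ "{n, n + 1}"]) (auto simp: spin_supp_def spin_grad_theta theta_grad_def)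

lemma supp_Gamma_lift: "spin_supp (Gamma_lift S L n) S \<subseteq> {L - 1..n + 1}"
proof
  fix k
  assume "k \<in> spin_supp (Gamma_lift S L n) S"
  then have "(\<Sum>l\<in>{L..n}. gamma_grad S l k) \<noteq> 0"
    by (simp add: spin_supp_def spin_grad_Gamma_lift)
  then obtain l where "l \<in> {L..n}" "gamma_grad S l k \<noteq> 0"
    by (meson sum.neutral)
  then show "k \<in> {L - 1..n + 1}"
    by (auto simp: gamma_grad_def split: if_splits)
qed

lemma finite_supp_Gamma_lift: "finite (spin_supp (Gamma_lift S L n) S)"
  using supp_Gamma_lift finite_subset by blast

section \<open>Half-angle identities and the summed gradient\<close>

lemma tan_half_theta_mult: "tan (\<theta> n / 2) * (1 + cos (\<theta> n)) = sin (\<theta> n)"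
  and one_plus_cos_theta_nonzero: "1 + cos (\<theta> n) \<noteq> 0"
proof -
  show nz: "1 + cos (\<theta> n) \<noteq> 0"
    using inner_consecutive[OF spin nonparallel, of n] theta_props(3)[OF spin nonparallel, of n] by simp
  then show "tan (\<theta> n / 2) * (1 + cos (\<theta> n)) = sin (\<theta> n)"
    using tan_half[of "\<theta> n / 2"] by (simp add: add.commute)
qed

lemma tan_half_theta: "tan (\<theta> n / 2) = inverse (sin (\<theta> n)) - cot (\<theta> n)"
proof -
  have "(1 + cos (\<theta> n)) * (tan (\<theta> n / 2) * sin (\<theta> n)) = sin (\<theta> n) * sin (\<theta> n)"
    unfolding tan_half_theta_mult[of n, symmetric] by (simp add: algebra_simps)
  also have "\<dots> = (1 + cos (\<theta> n)) * (1 - cos (\<theta> n))"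
    using sin_cos_squared_add[of "\<theta> n"] by (simp add: algebra_simps power2_eq_square)
  finally have "tan (\<theta> n / 2) * sin (\<theta> n) = 1 - cos (\<theta> n)"
    using one_plus_cos_theta_nonzero[of n] mult_left_cancel by blast
  then show ?thesis
    by (simp add: cot_def field_simps)
qed

text \<open>Only l = k-1, k, k+1 involve the spin at \<open>k\<close>, and \<open>L < k\<close>
  keeps all three above the lower cutoff. Hence only the upper cutoff \<open>n\<close> can truncate
  them, and the gradient does not depend on \<open>L\<close>.\<close>

lemma spin_grad_Gamma_lift_bulk:
  assumes "L < k"
  shows "spin_grad (Gamma_lift S L n) S k = Gamma_grad S n k"
proof -
  have "(\<Sum>l\<in>{L..n}. gamma_grad S l k) = (\<Sum>l\<in>{k - 1, k, k + 1} \<inter> {..n}. gamma_grad S l k)"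
    by (rule sum.mono_neutral_right) (use assms in \<open>auto simp: gamma_grad_def\<close>)
  also have "\<dots> = (\<Sum>l\<in>{k - 1, k, k + 1}. if l \<le> n then gamma_grad S l k else 0)"
    by (subst sum.inter_restrict) simp_all
  also have "\<dots> = Gamma_grad S n k"
    by (simp add: gamma_grad_def Gamma_grad_def tan_half_theta algebra_simps)
  finally show ?thesis by (simp add: spin_grad_Gamma_lift)
qed

section \<open>Brackets of angles\<close>

text \<open>Crossing a tangent vector twice with \<open>S j\<close> negates it, so the gradient of
  \<theta> crossed with the spin becomes \<open>- e k\<close> at site \<open>k\<close> and
  \<open>e k\<close> at site \<open>k + 1\<close>.\<close>

lemma spin_bracket_theta_right:
  assumes "finite (spin_supp F S)"
  shows "spin_bracket F (\<lambda>T. theta T k) S = (spin_grad F S (k + 1) - spin_grad F S k) \<bullet> e k"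
proof -
  have "spin_bracket F (\<lambda>T. theta T k) S
      = (\<Sum>j\<in>{k, k + 1}. spin_grad F S j \<bullet> cross3 (S j) (theta_grad S k j))"
    unfolding spin_grad_theta[symmetric]
    by (rule spin_bracket_eq_sum)
       (use assms finite_supp_theta in \<open>auto simp: spin_supp_def spin_grad_theta theta_grad_def\<close>)
  also have "\<dots> = (spin_grad F S (k + 1) - spin_grad F S k) \<bullet> e k"
    by (simp add: theta_grad_def cross_cross_orthogonal inner_diff_left)
  finally show ?thesis .
qed

lemma bracket_theta_theta_eq:
  "bracket_theta_theta S n k = (theta_grad S n (k + 1) - theta_grad S n k) \<bullet> e k"
  by (simp add: bracket_theta_theta_def spin_bracket_theta_right finite_supp_theta spin_grad_theta)

lemma bracket_Gamma_theta_eq: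
  "bracket_Gamma_theta S n k = (Gamma_grad S n (k + 1) - Gamma_grad S n k) \<bullet> e k"
  unfolding bracket_Gamma_theta_def
proof (rule tendsto_Lim)
  \<comment> \<open>This puts both sites \<open>k\<close> and \<open>k + 1\<close> into the bulk,
    where the bracket no longer depends on \<open>L\<close>.\<close>
  have "\<forall>\<^sub>F L in at_bot. L < k"
    using eventually_le_at_bot[of "k - 1"] by eventually_elim simp
  then show "((\<lambda>L. spin_bracket (Gamma_lift S L n) (\<lambda>T. theta T k) S) \<longlongrightarrow>
      (Gamma_grad S n (k + 1) - Gamma_grad S n k) \<bullet> e k) at_bot"
    by (intro tendsto_eventually)
       (auto elim!: eventually_mono
         simp: spin_bracket_theta_right finite_supp_Gamma_lift spin_grad_Gamma_lift_bulk)
qed simp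

text \<open>For sites \<open>k < m\<close> both gradients are equal, including those at the lower cutoff \<open>L\<close>, so only
  \<open>k = m\<close> and \<open>k = m + 1\<close> contribute.\<close>

lemma spin_bracket_Gamma_Gamma:
  assumes "m < n" "L < m"
  shows "spin_bracket (Gamma_lift S L n) (Gamma_lift S L m) S =
    (\<Sum>k\<in>{m, m + 1}. Gamma_grad S n k \<bullet> cross3 (S k) (Gamma_grad S m k))"
proof -
  let ?g = "\<lambda>k. spin_grad (Gamma_lift S L n) S k \<bullet> cross3 (S k) (spin_grad (Gamma_lift S L m) S k)"
  have "spin_bracket (Gamma_lift S L n) (Gamma_lift S L m) S = (\<Sum>k\<in>{L - 1..m + 1}. ?g k)"
    by (rule spin_bracket_eq_sum) (use finite_supp_Gamma_lift supp_Gamma_lift[of L m] in auto)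
  also have "\<dots> = (\<Sum>k\<in>{m, m + 1}. ?g k)"
  proof (rule sum.mono_neutral_right)
    show "\<forall>k\<in>{L - 1..m + 1} - {m, m + 1}. ?g k = 0"
    proof
      fix k assume "k \<in> {L - 1..m + 1} - {m, m + 1}"
      then have "k < m" by auto
      then have "(\<Sum>l\<in>{L..n}. gamma_grad S l k) = (\<Sum>l\<in>{L..m}. gamma_grad S l k)"
        by (intro sum.mono_neutral_right) (use assms in \<open>auto simp: gamma_grad_def\<close>)
      then show "?g k = 0"
        by (simp add: spin_grad_Gamma_lift dot_cross_self)
    qed
  qed (use assms in auto)
  also have "\<dots> = (\<Sum>k\<in>{m, m + 1}. Gamma_grad S n k \<bullet> cross3 (S k) (Gamma_grad S m k))"
    using assms by (intro sum.cong) (auto simp: spin_grad_Gamma_lift_bulk)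
  finally show ?thesis .
qed

lemma bracket_Gamma_Gamma_eq:
  assumes "m < n"
  shows "bracket_Gamma_Gamma S n m =
    (\<Sum>k\<in>{m, m + 1}. Gamma_grad S n k \<bullet> cross3 (S k) (Gamma_grad S m k))" (is "_ = ?s")
    and "bracket_Gamma_Gamma S m n = - bracket_Gamma_Gamma S n m"
proof -
  have ev: "\<forall>\<^sub>F L in at_bot. spin_bracket (Gamma_lift S L n) (Gamma_lift S L m) S = ?s"
    using eventually_le_at_bot[of "m - 1"]
    by eventually_elim (rule spin_bracket_Gamma_Gamma[OF assms], simp)
  show 1: "bracket_Gamma_Gamma S n m = ?s"
    unfolding bracket_Gamma_Gamma_def by (rule tendsto_Lim[OF _ tendsto_eventually[OF ev]]) simp
  \<comment> \<open>Antisymmetry is applied before the limit; eventual constancy then identifies the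
    limit of the swapped bracket.\<close>
  from ev have "\<forall>\<^sub>F L in at_bot. spin_bracket (Gamma_lift S L m) (Gamma_lift S L n) S = - ?s"
    by eventually_elim (simp add: spin_bracket_antisym[of "Gamma_lift S _ m"])
  then show "bracket_Gamma_Gamma S m n = - bracket_Gamma_Gamma S n m"
    unfolding 1 unfolding bracket_Gamma_Gamma_def by (intro tendsto_Lim tendsto_eventually) auto
qed

lemma bracket_Gamma_Gamma_self: "bracket_Gamma_Gamma S n n = 0"
proof -
  have "spin_bracket F F S = 0" for F
    using spin_bracket_antisym[of F F S] by simp
  then show ?thesis
    by (simp add: bracket_Gamma_Gamma_def tendsto_Lim)
qed

lemma bracket_Gamma_Gamma_antisym: "bracket_Gamma_Gamma S m n = - bracket_Gamma_Gamma S n m"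
  by (metis bracket_Gamma_Gamma_eq(2) bracket_Gamma_Gamma_self linorder_neqE minus_minus minus_zero)

lemma bracket_theta_theta_antisym: "bracket_theta_theta S m n = - bracket_theta_theta S n m"
  unfolding bracket_theta_theta_def by (rule spin_bracket_antisym)

end

section \<open>Brackets of Hasimoto coordinates\<close>

lemma hasimoto_domain_nonparallel: "hasimoto_domain S \<Longrightarrow> nonparallel_spin_field S"
  by (simp add: hasimoto_domain_def nonparallel_spin_field_def)

lemma gamma_eq_Gamma_diff:
  assumes "hasimoto_domain S"
  shows "gamma S n = Gamma S n - Gamma S (n - 1)"
proof -
  have "gamma S summable_on {..n - 1}"
    using assms unfolding hasimoto_domain_def by (meson subset_UNIV summable_on_subset_banach)
  moreover have "{..n} = insert n {..n - 1}" by auto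
  ultimately show ?thesis
    by (simp add: Gamma_def infsum_insert)
qed

text \<open>Both parts have the shape \<open>tan (x / 2) * p g\<close>, with the sign kept inside
  \<open>p\<close>, so \<open>hasimoto_bracket_eq\<close> covers all four pairings.\<close>

lemma alpha_of_parts:
  "re_alpha = (\<lambda>t g. tan (t / 2) * cos g)" "im_alpha = (\<lambda>t g. tan (t / 2) * - sin g)"
  by (auto simp: alpha_of_def exp_minus cis_conv_exp[symmetric] fun_eq_iff Re_exp Im_exp)

lemma alpha_simps:
  "Re (alpha S n) = tan (theta S n / 2) * cos (Gamma S n)"
  "Im (alpha S n) = - tan (theta S n / 2) * sin (Gamma S n)"
  "(cmod (alpha S n))\<^sup>2 = (tan (theta S n / 2))\<^sup>2"
proof -
  show 1: "Re (alpha S n) = tan (theta S n / 2) * cos (Gamma S n)"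
    "Im (alpha S n) = - tan (theta S n / 2) * sin (Gamma S n)"
    using fun_cong[OF fun_cong[OF alpha_of_parts(1)]] fun_cong[OF fun_cong[OF alpha_of_parts(2)]]
    by (simp_all add: alpha_def)
  show "(cmod (alpha S n))\<^sup>2 = (tan (theta S n / 2))\<^sup>2"
    unfolding cmod_power2 1 using sin_cos_squared_add[of "Gamma S n"] by algebra
qed

section \<open>Chain rule and explicit brackets of angles\<close>

context nonparallel_spin_field
begin

abbreviation "t n \<equiv> tan (\<theta> n / 2)"
abbreviation "G \<equiv> Gamma S"

text \<open>The derivative of \<open>tan (x / 2)\<close> at \<open>x = \<theta> n\<close>.\<close>

definition tan_rate :: "int \<Rightarrow> real" where
  "tan_rate n = (1 + (t n)\<^sup>2) / 2"

lemma hasimoto_bracket_antisym: "hasimoto_bracket h m f n S = - hasimoto_bracket f n h m S"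
  by (simp add: hasimoto_bracket_def Let_def bracket_theta_theta_antisym[of m n]
      bracket_Gamma_Gamma_antisym[of m n] algebra_simps)

lemma hasimoto_bracket_eq:
  assumes p: "(p has_real_derivative p') (at (G n))" and r: "(r has_real_derivative r') (at (G m))"
  shows "hasimoto_bracket (\<lambda>x g. tan (x / 2) * p g) n (\<lambda>x g. tan (x / 2) * r g) m S =
      tan_rate n * p (G n) * (tan_rate m * r (G m)) * bracket_theta_theta S n m
    - tan_rate n * p (G n) * (t m * r') * bracket_Gamma_theta S m n
    + t n * p' * (tan_rate m * r (G m)) * bracket_Gamma_theta S n m
    + t n * p' * (t m * r') * bracket_Gamma_Gamma S n m"
proof -
  have d: "deriv (\<lambda>x. tan (x / 2) * c) (\<theta> k) = tan_rate k * c" for c k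
  proof (rule DERIV_imp_deriv)
    have nz: "cos (\<theta> k / 2) \<noteq> 0"
      using theta_props(1,2)[OF spin nonparallel, of k] cos_gt_zero_pi[of "\<theta> k / 2"] by simp
    show "((\<lambda>x. tan (x / 2) * c) has_real_derivative tan_rate k * c) (at (\<theta> k))"
      by (auto intro!: derivative_eq_intros simp: tan_rate_def nz tan_sec[OF nz] power_inverse)
  qed
  have "deriv (\<lambda>g. c * p g) (G n) = c * p'" "deriv (\<lambda>g. c * r g) (G m) = c * r'" for c
    using p r by (auto intro!: DERIV_imp_deriv DERIV_cmult)
  then show ?thesis
    by (simp add: hasimoto_bracket_def Let_def d)
qed

lemma inner_binormal_succ: "e n \<bullet> e (n + 1) = cos (\<gamma> (n + 1))" "e (n + 1) \<bullet> e n = cos (\<gamma> (n + 1))"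
    "e n \<bullet> e (n - 1) = cos (\<gamma> n)"
  using inner_binormal_prev[of "n + 1"] inner_binormal_prev[of n] by (simp_all add: inner_commute)

lemma inner_cross_binormal_succ:
  "e n \<bullet> cross3 (S (n + 1)) (e (n + 1)) = - sin (\<gamma> (n + 1))"
  "e (n + 1) \<bullet> cross3 (S (n + 1)) (e n) = sin (\<gamma> (n + 1))"
  using inner_cross_binormal[of "n + 1"] by simp_all

lemmas binormal_simps = inner_binormal_prev inner_binormal_succ inner_cross_binormal
  inner_cross_binormal_succ inner_add_left inner_add_right inner_diff_left inner_diff_right
  cross_add_right cross_mult_right Cross3.right_diff_distrib dot_cross_self

text \<open>The half-angle formulas for sine and cosine. The weight (1+|alpha|^2)/2 thus arises from
  differentiating in \<Gamma> as well as in \<theta>.\<close>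

lemma tan_rate_eq: "t n / sin (\<theta> n) = tan_rate n" "t n * cot (\<theta> n) = 1 - tan_rate n"
proof -
  have "sin (\<theta> n) * t n = 1 - cos (\<theta> n)"
    using tan_half_theta[of n] by (simp add: cot_def field_simps)
  moreover have "t n * (1 + cos (\<theta> n)) = sin (\<theta> n)"
    by (rule tan_half_theta_mult)
  ultimately have 1: "2 * t n = (1 + (t n)\<^sup>2) * sin (\<theta> n)"
    and 2: "2 * t n * cos (\<theta> n) = (1 - (t n)\<^sup>2) * sin (\<theta> n)"
    by algebra+
  show "t n / sin (\<theta> n) = tan_rate n"
    using 1 by (simp add: tan_rate_def field_simps)
  have "t n * cot (\<theta> n) = (2 * t n * cos (\<theta> n)) / sin (\<theta> n) / 2"
    by (simp add: cot_def)
  also have "\<dots> = (1 - (t n)\<^sup>2) / 2"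
    unfolding 2 by simp
  also have "\<dots> = 1 - tan_rate n"
    by (simp add: tan_rate_def field_simps)
  finally show "t n * cot (\<theta> n) = 1 - tan_rate n" .
qed

text \<open>The spins of \<Gamma>(m) end at \<open>m + 1\<close>, before those of
  \<open>theta S n\<close>, whence the zeros. The last bracket carries the factor \<open>t m\<close>
  with which it enters the chain rule; it absorbs the denominator
  \<open>sin (\<theta> m)\<close>.\<close>

lemma brackets_far:
  assumes "m + 2 \<le> n"
  shows "bracket_theta_theta S n m = 0"
    and "bracket_Gamma_theta S m n = 0"
    and "bracket_Gamma_theta S n m = t (m + 1) * cos (\<gamma> (m + 1)) - t (m - 1) * cos (\<gamma> m)"
    and "t m * bracket_Gamma_Gamma S n m =
      tan_rate m * (t (m - 1) * sin (\<gamma> m) + t (m + 1) * sin (\<gamma> (m + 1)))"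
proof -
  show "bracket_theta_theta S n m = 0"
    using assms by (simp add: bracket_theta_theta_eq theta_grad_def)
  show "bracket_Gamma_theta S m n = 0"
    using assms by (simp add: bracket_Gamma_theta_eq Gamma_grad_def)
  show "bracket_Gamma_theta S n m = t (m + 1) * cos (\<gamma> (m + 1)) - t (m - 1) * cos (\<gamma> m)"
    using assms by (simp add: bracket_Gamma_theta_eq Gamma_grad_def binormal_simps)
  have "bracket_Gamma_Gamma S n m = t (m - 1) * sin (\<gamma> m) * (t m + cot (\<theta> m))
      + t (m + 1) * sin (\<gamma> (m + 1)) / sin (\<theta> m)"
    using assms by (simp add: bracket_Gamma_Gamma_eq Gamma_grad_def binormal_simps) (simp add: field_simps)
  also have "t m + cot (\<theta> m) = 1 / sin (\<theta> m)"
    by (simp add: tan_half_theta inverse_eq_divide)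
  finally have "bracket_Gamma_Gamma S n m =
      (t (m - 1) * sin (\<gamma> m) + t (m + 1) * sin (\<gamma> (m + 1))) / sin (\<theta> m)"
    by (simp add: add_divide_distrib)
  then show "t m * bracket_Gamma_Gamma S n m =
      tan_rate m * (t (m - 1) * sin (\<gamma> m) + t (m + 1) * sin (\<gamma> (m + 1)))"
    by (simp add: tan_rate_eq(1)[symmetric])
qed

lemma brackets_succ:
  "bracket_theta_theta S (m + 1) m = - sin (\<gamma> (m + 1))"
  "t m * bracket_Gamma_theta S m (m + 1) = - tan_rate m * cos (\<gamma> (m + 1))"
  "t (m + 1) * bracket_Gamma_theta S (m + 1) m =
    - (1 - tan_rate (m + 1)) * cos (\<gamma> (m + 1)) - t (m + 1) * t (m - 1) * cos (\<gamma> m)"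
  "t m * (t (m + 1) * bracket_Gamma_Gamma S (m + 1) m) =
    tan_rate m * (t (m + 1) * t (m - 1) * sin (\<gamma> m) - (1 - tan_rate (m + 1)) * sin (\<gamma> (m + 1)))"
proof -
  show "bracket_theta_theta S (m + 1) m = - sin (\<gamma> (m + 1))"
    by (simp add: bracket_theta_theta_eq theta_grad_def inner_commute[of "cross3 _ _"] binormal_simps)
  show "t m * bracket_Gamma_theta S m (m + 1) = - tan_rate m * cos (\<gamma> (m + 1))"
    unfolding tan_rate_eq(1)[symmetric]
    by (simp add: bracket_Gamma_theta_eq Gamma_grad_def binormal_simps inverse_eq_divide)
  show "t (m + 1) * bracket_Gamma_theta S (m + 1) m =
      - (1 - tan_rate (m + 1)) * cos (\<gamma> (m + 1)) - t (m + 1) * t (m - 1) * cos (\<gamma> m)"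
    unfolding tan_rate_eq(2)[symmetric]
    by (simp add: bracket_Gamma_theta_eq Gamma_grad_def binormal_simps) (simp add: algebra_simps)
  have "bracket_Gamma_Gamma S (m + 1) m = t (m - 1) * sin (\<gamma> m) * (t m + cot (\<theta> m))
      - cot (\<theta> (m + 1)) * sin (\<gamma> (m + 1)) / sin (\<theta> m)"
    by (simp add: bracket_Gamma_Gamma_eq Gamma_grad_def binormal_simps) (simp add: field_simps)
  also have "t m + cot (\<theta> m) = 1 / sin (\<theta> m)"
    by (simp add: tan_half_theta inverse_eq_divide)
  finally have eq: "bracket_Gamma_Gamma S (m + 1) m =
      (t (m - 1) * sin (\<gamma> m) - cot (\<theta> (m + 1)) * sin (\<gamma> (m + 1))) / sin (\<theta> m)"
    by (simp add: diff_divide_distrib)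
  show "t m * (t (m + 1) * bracket_Gamma_Gamma S (m + 1) m) =
      tan_rate m * (t (m + 1) * t (m - 1) * sin (\<gamma> m) - (1 - tan_rate (m + 1)) * sin (\<gamma> (m + 1)))"
    unfolding eq tan_rate_eq(1)[of m, symmetric] tan_rate_eq(2)[of "m + 1", symmetric]
    by (simp add: algebra_simps diff_divide_distrib)
qed

lemma brackets_same:
  "bracket_theta_theta S n n = 0"
  "t n * bracket_Gamma_theta S n n = 1 - t n * t (n - 1) * cos (\<gamma> n)"
proof -
  show "bracket_theta_theta S n n = 0"
    using bracket_theta_theta_antisym[of n n] by simp
  \<comment> \<open>The two coefficients of \<open>e n\<close> contribute \<open>tan_rate n\<close>
    and \<open>1 - tan_rate n\<close>, which add up to 1.\<close>
  have "t n * bracket_Gamma_theta S n n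
      = t n / sin (\<theta> n) + t n * cot (\<theta> n) - t n * t (n - 1) * cos (\<gamma> n)"
    by (simp add: bracket_Gamma_theta_eq Gamma_grad_def binormal_simps inverse_eq_divide algebra_simps)
  then show "t n * bracket_Gamma_theta S n n = 1 - t n * t (n - 1) * cos (\<gamma> n)"
    unfolding tan_rate_eq by simp
qed

lemma hasimoto_bracket_re_im:
  shows "hasimoto_bracket re_alpha n re_alpha m S =
      tan_rate n * cos (G n) * (tan_rate m * cos (G m)) * bracket_theta_theta S n m
    + tan_rate n * cos (G n) * (t m * sin (G m)) * bracket_Gamma_theta S m n
    - t n * sin (G n) * (tan_rate m * cos (G m)) * bracket_Gamma_theta S n m
    + t n * sin (G n) * (t m * sin (G m)) * bracket_Gamma_Gamma S n m" (is ?re_re)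
    and "hasimoto_bracket re_alpha n im_alpha m S =
    - tan_rate n * cos (G n) * (tan_rate m * sin (G m)) * bracket_theta_theta S n m
    + tan_rate n * cos (G n) * (t m * cos (G m)) * bracket_Gamma_theta S m n
    + t n * sin (G n) * (tan_rate m * sin (G m)) * bracket_Gamma_theta S n m
    + t n * sin (G n) * (t m * cos (G m)) * bracket_Gamma_Gamma S n m" (is ?re_im)
    and "hasimoto_bracket im_alpha n re_alpha m S =
    - tan_rate n * sin (G n) * (tan_rate m * cos (G m)) * bracket_theta_theta S n m
    - tan_rate n * sin (G n) * (t m * sin (G m)) * bracket_Gamma_theta S m n
    - t n * cos (G n) * (tan_rate m * cos (G m)) * bracket_Gamma_theta S n m
    + t n * cos (G n) * (t m * sin (G m)) * bracket_Gamma_Gamma S n m" (is ?im_re)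
    and "hasimoto_bracket im_alpha n im_alpha m S =
      tan_rate n * sin (G n) * (tan_rate m * sin (G m)) * bracket_theta_theta S n m
    - tan_rate n * sin (G n) * (t m * cos (G m)) * bracket_Gamma_theta S m n
    + t n * cos (G n) * (tan_rate m * sin (G m)) * bracket_Gamma_theta S n m
    + t n * cos (G n) * (t m * cos (G m)) * bracket_Gamma_Gamma S n m" (is ?im_im)
proof -
  have c: "(cos has_real_derivative - sin x) (at x)"
    and s: "((\<lambda>g. - sin g) has_real_derivative - cos x) (at x)" for x :: real
    by (auto intro!: derivative_eq_intros)
  show ?re_re ?re_im ?im_re ?im_im
    unfolding alpha_of_parts hasimoto_bracket_eq[OF c c] hasimoto_bracket_eq[OF c s]
      hasimoto_bracket_eq[OF s c] hasimoto_bracket_eq[OF s s]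
    by (simp_all add: algebra_simps)
qed

section \<open>From angle brackets to brackets of the alphas by angle addition\<close>

context
  fixes n m :: int
  assumes gamma_diff: "\<And>k. \<gamma> k = G k - G (k - 1)"
begin

lemma gamma_diff_succ: "\<gamma> (k + 1) = G (k + 1) - G k"
  using gamma_diff[of "k + 1"] by simp

lemma hasimoto_bracket_far:
  assumes "m + 2 \<le> n"
  shows "hasimoto_bracket re_alpha n re_alpha m S
      = - tan_rate m * Im (alpha S n) * Re (alpha S (m - 1) - alpha S (m + 1))"
    and "hasimoto_bracket re_alpha n im_alpha m S
      = - tan_rate m * Im (alpha S n) * Im (alpha S (m - 1) - alpha S (m + 1))"
    and "hasimoto_bracket im_alpha n re_alpha m S
      = tan_rate m * Re (alpha S n) * Re (alpha S (m - 1) - alpha S (m + 1))"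
    and "hasimoto_bracket im_alpha n im_alpha m S
      = tan_rate m * Re (alpha S n) * Im (alpha S (m - 1) - alpha S (m + 1))"
  unfolding hasimoto_bracket_re_im tan_rate_def[symmetric] brackets_far(1,2)[OF assms]
    alpha_simps minus_complex.sel
  using brackets_far(3,4)[OF assms] sin_cos_squared_add[of "G m"]
  unfolding gamma_diff_succ gamma_diff[of m] cos_diff sin_diff
  by algebra+

text \<open>Compared with the far formula, each of the four chain-rule terms is corrected by
  \<open>tan_rate m * tan_rate (m + 1)\<close> times a sine or cosine of gamma_(m+1). With
  gamma_(m+1) = Gamma(m+1) - Gamma(m) these sum to plus or minus sin^2 + cos^2 in the mixed brackets
  and to 0 in the other two.\<close>

lemma hasimoto_bracket_succ:
  shows "hasimoto_bracket re_alpha (m + 1) re_alpha m S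
      = - tan_rate m * Im (alpha S (m + 1)) * Re (alpha S (m - 1) - alpha S (m + 1))"
    and "hasimoto_bracket re_alpha (m + 1) im_alpha m S
      = - tan_rate m * (Im (alpha S (m + 1)) * Im (alpha S (m - 1) - alpha S (m + 1)) + tan_rate (m + 1))"
    and "hasimoto_bracket im_alpha (m + 1) re_alpha m S
      = tan_rate m * (Re (alpha S (m + 1)) * Re (alpha S (m - 1) - alpha S (m + 1)) + tan_rate (m + 1))"
    and "hasimoto_bracket im_alpha (m + 1) im_alpha m S
      = tan_rate m * Re (alpha S (m + 1)) * Im (alpha S (m - 1) - alpha S (m + 1))"
proof -
  \<comment> \<open>Makes the far coefficient \<open>(t (m + 1))\<^sup>2\<close> comparable with the
    actual \<open>- (1 - tan_rate (m + 1))\<close>; they differ by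
    \<open>tan_rate (m + 1)\<close>.\<close>
  have sq: "(t (m + 1))\<^sup>2 = 2 * tan_rate (m + 1) - 1"
    by (simp add: tan_rate_def field_simps)
  note facts = brackets_succ[of m, unfolded gamma_diff_succ gamma_diff[of m] cos_diff sin_diff]
    sin_cos_squared_add[of "G m"] sin_cos_squared_add[of "G (m + 1)"] sq
  show "hasimoto_bracket re_alpha (m + 1) re_alpha m S
      = - tan_rate m * Im (alpha S (m + 1)) * Re (alpha S (m - 1) - alpha S (m + 1))"
    unfolding hasimoto_bracket_re_im alpha_simps minus_complex.sel using facts by algebra
  show "hasimoto_bracket re_alpha (m + 1) im_alpha m S
      = - tan_rate m * (Im (alpha S (m + 1)) * Im (alpha S (m - 1) - alpha S (m + 1)) + tan_rate (m + 1))"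
    unfolding hasimoto_bracket_re_im alpha_simps minus_complex.sel using facts by algebra
  show "hasimoto_bracket im_alpha (m + 1) re_alpha m S
      = tan_rate m * (Re (alpha S (m + 1)) * Re (alpha S (m - 1) - alpha S (m + 1)) + tan_rate (m + 1))"
    unfolding hasimoto_bracket_re_im alpha_simps minus_complex.sel using facts by algebra
  show "hasimoto_bracket im_alpha (m + 1) im_alpha m S
      = tan_rate m * Re (alpha S (m + 1)) * Im (alpha S (m - 1) - alpha S (m + 1))"
    unfolding hasimoto_bracket_re_im alpha_simps minus_complex.sel using facts by algebra
qed

text \<open>The two remaining terms carry the same bracket {Gamma(n), theta_n} with weights cos^2
  and sin^2 of Gamma(n), and \<open>t n * t (n - 1) * cos (\<gamma> n)\<close> is the real part on
  the right.\<close>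

lemma hasimoto_bracket_same:
  "hasimoto_bracket re_alpha n im_alpha n S
    = tan_rate n - tan_rate n * Re (alpha S n * cnj (alpha S (n - 1)))"
  unfolding hasimoto_bracket_re_im alpha_simps times_complex.sel complex_cnj brackets_same(1)
    bracket_Gamma_Gamma_self cnj.sel
  using brackets_same(2)[of n] sin_cos_squared_add[of "G n"]
  unfolding gamma_diff[of n] cos_diff
  by algebra

end

lemma tan_rate_alpha: "(1 + (cmod (alpha S n))\<^sup>2) / 2 = tan_rate n"
  by (simp add: tan_rate_def alpha_simps)

end

theorem proposition2p5:
  fixes S :: "int \<Rightarrow> real^3" and n m :: int
  assumes "hasimoto_domain S"
  shows
    "(n \<ge> m + 2 \<longrightarrow>
       hasimoto_bracket re_alpha n im_alpha m S
       = - ((1 + (cmod (alpha S m))\<^sup>2) / 2)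
           * (Im (alpha S n) * Im (alpha S (m - 1) - alpha S (m + 1)))) \<and>
     (n = m + 1 \<longrightarrow>
       hasimoto_bracket re_alpha n im_alpha m S
       = - ((1 + (cmod (alpha S m))\<^sup>2) / 2)
           * (Im (alpha S n) * Im (alpha S (m - 1) - alpha S (m + 1))
              + (1 + (cmod (alpha S n))\<^sup>2) / 2)) \<and>
     (n = m \<longrightarrow>
       hasimoto_bracket re_alpha n im_alpha m S
       = (1 + (cmod (alpha S n))\<^sup>2) / 2
         - (1 + (cmod (alpha S n))\<^sup>2) / 2 * Re (alpha S n * cnj (alpha S (n - 1)))) \<and>
     (n = m - 1 \<longrightarrow>
       hasimoto_bracket re_alpha n im_alpha m S
       = - ((1 + (cmod (alpha S n))\<^sup>2) / 2)
           * (Re (alpha S m) * Re (alpha S (n - 1) - alpha S (n + 1))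
              + (1 + (cmod (alpha S m))\<^sup>2) / 2)) \<and>
     (n \<le> m - 2 \<longrightarrow>
       hasimoto_bracket re_alpha n im_alpha m S
       = - ((1 + (cmod (alpha S n))\<^sup>2) / 2)
           * (Re (alpha S m) * Re (alpha S (n - 1) - alpha S (n + 1)))) \<and>
     (n \<ge> m + 1 \<longrightarrow>
       hasimoto_bracket re_alpha n re_alpha m S
       = - ((1 + (cmod (alpha S m))\<^sup>2) / 2)
           * (Im (alpha S n) * Re (alpha S (m - 1) - alpha S (m + 1)))) \<and>
     (n \<ge> m + 1 \<longrightarrow>
       hasimoto_bracket im_alpha n im_alpha m S
       = (1 + (cmod (alpha S m))\<^sup>2) / 2
           * (Re (alpha S n) * Im (alpha S (m - 1) - alpha S (m + 1)))) \<and>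
     (hasimoto_bracket re_alpha m re_alpha n S = - hasimoto_bracket re_alpha n re_alpha m S) \<and>
     (hasimoto_bracket im_alpha m im_alpha n S = - hasimoto_bracket im_alpha n im_alpha m S) \<and>
     (hasimoto_bracket im_alpha m re_alpha n S = - hasimoto_bracket re_alpha n im_alpha m S)"
proof -
  interpret nonparallel_spin_field S
    using assms by (rule hasimoto_domain_nonparallel)
  note gd = gamma_eq_Gamma_diff[OF assms]
  note far = hasimoto_bracket_far[OF gd] and succ = hasimoto_bracket_succ[OF gd]
  note anti = hasimoto_bracket_antisym[of re_alpha m re_alpha n]
    hasimoto_bracket_antisym[of im_alpha m im_alpha n] hasimoto_bracket_antisym[of im_alpha m re_alpha n]
  consider "m + 2 \<le> n" | "n = m + 1" | "n = m" | "m = n + 1" | "n + 2 \<le> m"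
    by linarith
  then show ?thesis
  proof cases
    case 1
    then show ?thesis
      by (simp add: far anti tan_rate_alpha)
  next
    case 2
    then show ?thesis
      using anti by (simp add: succ tan_rate_alpha)
  next
    case 3
    then show ?thesis
      using anti hasimoto_bracket_same[OF gd, of n] by (simp add: tan_rate_alpha)
  next
    \<comment> \<open>The larger index is now \<open>m\<close>, so the mixed bracket is flipped to
      have \<open>im_alpha m\<close> first, opposite to \<open>anti(3)\<close>, and
      \<open>succ\<close> applies with \<open>n\<close> as its lower index.\<close>
    case 4
    then show ?thesis
      using anti(1,2) hasimoto_bracket_antisym[of re_alpha n im_alpha m]
      by (simp add: succ tan_rate_alpha)
  next
    case 5
    then show ?thesis
      using anti by (simp add: far tan_rate_alpha)
  qed
qed

end
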